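(* For every integer $n\ge 7$, $$ex_{\mathcal{OP}}(n,S_{2,3})\ge\begin{cases}\frac{5n-3}{3}, & \text{if } n\equiv 0 \pmod 6,\\ \frac{5n-5}{3}, & \text{if } n\equiv 1 \pmod 6,\\ \frac{5n+i-9}{3}, & \text{if } n\equiv i \pmod 6,\ i\in\{2,3,4,5\}.\end{cases}$$
   Context: All graphs are finite, simple and undirected. For integers $q\ge p\ge 1$, the double star $S_{p,q}$ is the graph obtained from an edge $xy$ by joining $x$ to $p$ new vertices and $y$ to $q$ further new vertices. A graph is $H$-free if it contains no subgraph isomorphic to $H$. A graph is outerplanar if it has a planar embedding with all vertices on the boundary of the outer face. $ex_{\mathcal{OP}}(n,H)$ denotes the maximum number of edges of an $H$-free outerplanar graph on $n$ vertices. *)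

theory Defs
  imports "HOL-Analysis.Analysis"
begin

datatype 'a graph = Graph (verts: "'a set") (edges: "'a set set")

definition simple_graph :: "'a graph \<Rightarrow> bool" where
  "simple_graph G \<longleftrightarrow> finite (verts G) \<and> (\<forall>e\<in>edges G. e \<subseteq> verts G \<and> card e = 2)"

definition subgraph :: "'a graph \<Rightarrow> 'a graph \<Rightarrow> bool" where
  "subgraph G' G \<longleftrightarrow> simple_graph G' \<and> verts G' \<subseteq> verts G \<and> edges G' \<subseteq> edges G"

definition isomorphic :: "'a graph \<Rightarrow> 'b graph \<Rightarrow> bool" where
  "isomorphic G H \<longleftrightarrow>
     (\<exists>f. bij_betw f (verts G) (verts H) \<and>
          (\<forall>u\<in>verts G. \<forall>v\<in>verts G. {u, v} \<in> edges G \<longleftrightarrow> {f u, f v} \<in> edges H))"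

definition graph_free :: "'b graph \<Rightarrow> 'a graph \<Rightarrow> bool" where
  "graph_free H G \<longleftrightarrow> \<not> (\<exists>G'. subgraph G' G \<and> isomorphic G' H)"

text \<open>The central edge is \<open>{0, 1}\<close>; the leaves at \<open>0\<close> are \<open>2, \<dots>, p + 1\<close> and
  the leaves at \<open>1\<close> are \<open>p + 2, \<dots>, p + q + 1\<close>.\<close>
definition double_star :: "nat \<Rightarrow> nat \<Rightarrow> nat graph" where
  "double_star p q = Graph {..<p + q + 2}
     ({{0, 1}} \<union> (\<lambda>i. {0, i}) ` {2..<p + 2} \<union> (\<lambda>j. {1, j}) ` {p + 2..<p + q + 2})"

text \<open>Vertices are drawn as the points \<open>pos v\<close> and edges as the simple arcs \<open>curve e\<close>.\<close>
definition planar_embedding ::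
  "'a graph \<Rightarrow> ('a \<Rightarrow> complex) \<Rightarrow> ('a set \<Rightarrow> real \<Rightarrow> complex) \<Rightarrow> bool" where
  "planar_embedding G pos curve \<longleftrightarrow>
     inj_on pos (verts G) \<and>
     (\<forall>e\<in>edges G. arc (curve e) \<and>
        {pathstart (curve e), pathfinish (curve e)} = pos ` e \<and>
        path_image (curve e) \<inter> pos ` verts G = pos ` e) \<and>
     (\<forall>e\<in>edges G. \<forall>e'\<in>edges G. e \<noteq> e' \<longrightarrow>
        path_image (curve e) \<inter> path_image (curve e') = pos ` (e \<inter> e'))"

definition drawing ::
  "'a graph \<Rightarrow> ('a \<Rightarrow> complex) \<Rightarrow> ('a set \<Rightarrow> real \<Rightarrow> complex) \<Rightarrow> complex set" where
  "drawing G pos curve = pos ` verts G \<union> (\<Union>e\<in>edges G. path_image (curve e))"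

text \<open>The drawing of a finite graph is compact, so \<^const>\<open>outside\<close> of it is the unique
  unbounded component of its complement, that is, the outer face.\<close>
definition outerplanar :: "'a graph \<Rightarrow> bool" where
  "outerplanar G \<longleftrightarrow>
     (\<exists>pos curve. planar_embedding G pos curve \<and>
        pos ` verts G \<subseteq> frontier (outside (drawing G pos curve)))"

text \<open>Every finite graph is isomorphic to one with natural numbers as vertices, so it suffices
  to range over the latter.\<close>
definition outerplanar_edge_counts :: "nat \<Rightarrow> 'b graph \<Rightarrow> nat set" where
  "outerplanar_edge_counts n H =
     {card (edges G) | G :: nat graph.
        simple_graph G \<and> card (verts G) = n \<and> outerplanar G \<and> graph_free H G}"

definition ex_OP :: "nat \<Rightarrow> 'b graph \<Rightarrow> nat" where
  "ex_OP n H = Max (outerplanar_edge_counts n H)"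

lemma finite_outerplanar_edge_counts: "finite (outerplanar_edge_counts n H)"
proof -
  have "card (edges G) \<le> 2 ^ n" if "simple_graph G" "card (verts G) = n" for G :: "nat graph"
  proof -
    have "edges G \<subseteq> Pow (verts G)" "finite (verts G)"
      using that by (auto simp: simple_graph_def)
    then have "card (edges G) \<le> card (Pow (verts G))"
      by (intro card_mono) auto
    then show ?thesis
      using that \<open>finite (verts G)\<close> by (simp add: card_Pow)
  qed
  then have "outerplanar_edge_counts n H \<subseteq> {..2 ^ n}"
    by (auto simp: outerplanar_edge_counts_def)
  then show ?thesis
    using finite_subset by blast
qed

end

theory Submission
  imports Defs
begin

text \<open>Chain together copies of the hexagon triangulated by an inner triangle: consecutive copies are
  joined by one edge between vertices that have degree two in their hexagons. A hexagon has 9 edges,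
  so every 6 vertices contribute 10 edges. The vertices of a hexagon can be added one by one such
  that the first two bring one edge each, counting the link, and all later ones two; stopping within
  a hexagon gives the remaining residues of \<open>n\<close> modulo 6. The double star is excluded because an
  edge \<open>xy\<close> with \<open>deg y \<ge> 4\<close> lies inside one hexagon and satisfies \<open>|N(x) \<union> N(y)| \<le> 6\<close>.
  For outerplanarity, the vertices are put on a parabola, in an order in which no two edges cross as
  chords; the region below the parabola then lies in the outer face.\<close>

section \<open>Outerplanarity from non-crossing chords of a parabola\<close>

definition parab :: "real \<Rightarrow> complex" where
  "parab x = Complex x (x\<^sup>2)"

lemma Re_parab [simp]: "Re (parab x) = x" and Im_parab [simp]: "Im (parab x) = x\<^sup>2"
  by (simp_all add: parab_def)

lemma parab_eq_iff [simp]: "parab x = parab y \<longleftrightarrow> x = y"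
  by (auto simp: parab_def)

text \<open>On a chord the height above the parabola is the product of the horizontal distances to
  its two ends, so a meeting point of chords satisfies an equation in \<open>Re z\<close>
  alone.\<close>

lemma parab_chord:
  assumes "z \<in> closed_segment (parab a) (parab b)" "a < b"
  shows "a \<le> Re z" "Re z \<le> b" "Im z - (Re z)\<^sup>2 = (Re z - a) * (b - Re z)"
proof -
  obtain u where u: "0 \<le> u" "u \<le> 1" and z: "z = (1 - u) *\<^sub>R parab a + u *\<^sub>R parab b"
    using assms(1) by (auto simp: in_segment)
  have Re: "Re z = a + u * (b - a)"
    by (simp add: z algebra_simps)
  have Im: "Im z = (1 - u) * a\<^sup>2 + u * b\<^sup>2"
    by (simp add: z)
  show "a \<le> Re z"
    using u assms(2) by (simp add: Re)
  have "u * (b - a) \<le> 1 * (b - a)"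
    using u assms(2) by (intro mult_right_mono) auto
  then show "Re z \<le> b"
    by (simp add: Re)
  show "Im z - (Re z)\<^sup>2 = (Re z - a) * (b - Re z)"
    unfolding Re Im by (simp add: algebra_simps power2_eq_square)
qed

text \<open>The outer product minus the inner one splits into two nonnegative terms; both vanish at
  a meeting point, which forces a common endpoint there.\<close>

lemma nested_chords_meet:
  fixes a b c d x :: real
  assumes "a \<le> c" "d \<le> b" "c \<le> x" "x \<le> d"
    and eq: "(x - a) * (b - x) = (x - c) * (d - x)" and ne: "a \<noteq> c \<or> b \<noteq> d"
  shows "x = a \<and> x = c \<or> x = b \<and> x = d"
proof -
  have "(x - a) * (b - x) = (x - c) * (d - x) + (c - a) * (b - x) + (x - c) * (b - d)"
    by (simp add: algebra_simps)
  moreover have "0 \<le> (c - a) * (b - x)" "0 \<le> (x - c) * (b - d)"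
    using assms by auto
  ultimately have "(c - a) * (b - x) = 0" "(x - c) * (b - d) = 0"
    using eq by linarith+
  then show ?thesis
    using assms by auto
qed

text \<open>Noncrossing intervals are nested or share at most an endpoint;
  \<open>nested_chords_meet\<close> settles the nested case.\<close>

lemma noncrossing_parab_chords:
  fixes a b c d :: real
  assumes "a < b" "c < d"
    and z: "z \<in> closed_segment (parab a) (parab b)" "z \<in> closed_segment (parab c) (parab d)"
    and nc: "\<not> (a < c \<and> c < b \<and> b < d)" "\<not> (c < a \<and> a < d \<and> d < b)"
    and ne: "a \<noteq> c \<or> b \<noteq> d"
  shows "Re z \<in> {a, b} \<inter> {c, d} \<and> z = parab (Re z)"
proof -
  note ab = parab_chord[OF z(1) \<open>a < b\<close>] and cd = parab_chord[OF z(2) \<open>c < d\<close>]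
  have eq: "(Re z - a) * (b - Re z) = (Re z - c) * (d - Re z)"
    using ab(3) cd(3) by simp
  consider "b \<le> c" | "d \<le> a" | "a \<le> c" "d \<le> b" | "c \<le> a" "b \<le> d"
    using nc by linarith
  then have "Re z \<in> {a, b} \<inter> {c, d}"
  proof cases
    case 3
    then show ?thesis
      using nested_chords_meet[OF 3 cd(1,2) eq ne] by auto
  next
    case 4
    then show ?thesis
      using nested_chords_meet[OF 4 ab(1,2) eq[symmetric]] ne by auto
  qed (use ab cd in auto)
  moreover from this have "Im z = (Re z)\<^sup>2"
    using ab(3) by auto
  ultimately show ?thesis
    by (simp add: complex_eq_iff)
qed

text \<open>The downward vertical ray from \<open>w\<close> misses \<open>S\<close> and is
  unbounded, so the component containing \<open>w\<close> is unbounded too.\<close>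

lemma below_parab_in_outside:
  assumes S: "\<And>z. z \<in> S \<Longrightarrow> (Re z)\<^sup>2 \<le> Im z" and w: "Im w < (Re w)\<^sup>2"
  shows "w \<in> outside S"
proof -
  define R where "R = {z. Re z = Re w} \<inter> {z. Im z \<le> Im w}"
  have "convex R"
    unfolding R_def
    by (intro convex_Int convex_halfspace_Im_le) (auto simp: convex_def simp flip: distrib_right)
  moreover have "R \<subseteq> - S"
    using w by (force simp: R_def dest: S)
  ultimately have sub: "R \<subseteq> connected_component_set (- S) w"
    by (intro connected_component_maximal) (auto simp: R_def convex_connected)
  have "\<not> bounded R"
  proof
    assume "bounded R"
    then obtain B where B: "\<And>z. z \<in> R \<Longrightarrow> norm z \<le> B"
      by (auto simp: bounded_iff)
    \<comment> \<open>Far enough down the ray that the imaginary part is at most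
      \<open>- 1 - \<bar>B\<bar>\<close>.\<close>
    define z where "z = Complex (Re w) (Im w - \<bar>Im w\<bar> - \<bar>B\<bar> - 1)"
    have "norm z \<le> B"
      by (rule B) (simp add: R_def z_def)
    then have "\<bar>Im z\<bar> \<le> B"
      using abs_Im_le_cmod order_trans by blast
    then show False
      by (auto simp: z_def)
  qed
  then have "\<not> bounded (connected_component_set (- S) w)"
    using sub bounded_subset by blast
  moreover have "w \<notin> S"
    using S w by fastforce
  ultimately show ?thesis
    by (simp add: outside_def)
qed

text \<open>Edges are drawn as straight chords. The drawing lies on or above the parabola and the
  vertices on it, so points of the outer face lie arbitrarily close below each vertex.\<close>

lemma outerplanar_if_noncrossing:
  fixes f :: "'a \<Rightarrow> real"
  assumes G: "simple_graph G" and inj: "inj_on f (verts G)"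
    and nc: "\<And>a b c d. {a, b} \<in> edges G \<Longrightarrow> {c, d} \<in> edges G \<Longrightarrow>
      \<not> (f a < f c \<and> f c < f b \<and> f b < f d)"
  shows "outerplanar G"
proof -
  have "\<exists>s t. e = {s, t} \<and> f s < f t" if e: "e \<in> edges G" for e
  proof -
    obtain s t where st: "e = {s, t}" "s \<noteq> t" "s \<in> verts G" "t \<in> verts G"
      using G e by (fastforce simp: simple_graph_def card_2_iff)
    then have "f s \<noteq> f t"
      using inj by (auto dest: inj_onD)
    then consider "f s < f t" | "f t < f s"
      by linarith
    then show ?thesis
      using st(1) by cases (auto simp: insert_commute)
  qed
  then obtain s t where st: "\<And>e. e \<in> edges G \<Longrightarrow> e = {s e, t e} \<and> f (s e) < f (t e)"
    by metis
  have in_verts: "s e \<in> verts G" "t e \<in> verts G" if "e \<in> edges G" for e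
    using G st[OF that] that unfolding simple_graph_def by blast+
  define pos where "pos = parab \<circ> f"
  define curve where "curve e = linepath (pos (s e)) (pos (t e))" for e
  have img: "path_image (curve e) = closed_segment (parab (f (s e))) (parab (f (t e)))" for e
    by (simp add: curve_def pos_def)
  have ends: "pos ` e \<subseteq> path_image (curve e)" if "e \<in> edges G" for e
    using st[OF that] by (metis (no_types, lifting) curve_def ends_in_segment image_subsetI
      insertE path_image_linepath singletonD)
  have above: "(Re z)\<^sup>2 \<le> Im z" if "e \<in> edges G" "z \<in> path_image (curve e)" for e z
  proof -
    note chord = parab_chord[OF that(2)[unfolded img] conjunct2[OF st[OF that(1)]]]
    have "0 \<le> Im z - (Re z)\<^sup>2"
      unfolding chord(3) using chord(1,2) by simp
    then show ?thesis
      by simp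
  qed
  \<comment> \<open>A point of the parabola has height zero, so it can lie on a chord only as an
    end.\<close>
  have on_vertex: "v \<in> e" if "e \<in> edges G" "v \<in> verts G" "pos v \<in> path_image (curve e)" for e v
  proof -
    note e = st[OF that(1)]
    have "(f v - f (s e)) * (f (t e) - f v) = 0"
      using parab_chord(3)[of "pos v" "f (s e)" "f (t e)"] that(3) e by (simp add: img pos_def)
    then have "v = s e \<or> v = t e"
      using inj that(2) in_verts[OF that(1)] by (auto dest: inj_onD)
    then show ?thesis
      using e by blast
  qed
  have meet: "z \<in> pos ` (e \<inter> e')"
    if e: "e \<in> edges G" "e' \<in> edges G" "e \<noteq> e'"
      and z: "z \<in> path_image (curve e)" "z \<in> path_image (curve e')" for e e' z
  proof -
    note se = st[OF e(1)] and se' = st[OF e(2)]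
    have "f (s e) \<noteq> f (s e') \<or> f (t e) \<noteq> f (t e')"
      using se se' e(3) inj in_verts[OF e(1)] in_verts[OF e(2)] by (metis inj_onD)
    \<comment> \<open>\<open>nc\<close> excludes one crossing pattern; the other follows by
      exchanging the two edges.\<close>
    moreover have "\<not> (f (s e) < f (s e') \<and> f (s e') < f (t e) \<and> f (t e) < f (t e'))"
      "\<not> (f (s e') < f (s e) \<and> f (s e) < f (t e') \<and> f (t e') < f (t e))"
      using nc[of "s e" "t e" "s e'" "t e'"] nc[of "s e'" "t e'" "s e" "t e"] se se' e by auto
    ultimately have *: "Re z \<in> {f (s e), f (t e)} \<inter> {f (s e'), f (t e')}" "z = parab (Re z)"
      using noncrossing_parab_chords[of "f (s e)" "f (t e)" "f (s e')" "f (t e')" z]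
        se se' z by (auto simp: img)
    then obtain v where v: "v \<in> {s e, t e}" "Re z = f v"
      by auto
    have "v \<in> verts G" "pos v = z"
      using v in_verts[OF e(1)] *(2) by (auto simp: pos_def)
    then show ?thesis
      using on_vertex z e by blast
  qed
  have "planar_embedding G pos curve"
    unfolding planar_embedding_def
  proof (intro conjI ballI impI)
    show "inj_on pos (verts G)"
      using inj by (auto simp: pos_def inj_on_def)
  next
    fix e assume e: "e \<in> edges G"
    show "arc (curve e)"
      using st[OF e] by (auto simp: curve_def pos_def)
    have "pos ` e = pos ` {s e, t e}"
      using st[OF e] by simp
    then show "{pathstart (curve e), pathfinish (curve e)} = pos ` e"
      by (simp add: curve_def)
    have "e \<subseteq> verts G"
      using G e by (auto simp: simple_graph_def)
    then show "path_image (curve e) \<inter> pos ` verts G = pos ` e"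
      using on_vertex[OF e] ends[OF e] by blast
  next
    fix e e' assume e: "e \<in> edges G" "e' \<in> edges G" "e \<noteq> e'"
    show "path_image (curve e) \<inter> path_image (curve e') = pos ` (e \<inter> e')"
      using meet[OF e] ends[OF e(1)] ends[OF e(2)] by blast
  qed
  moreover have "pos ` verts G \<subseteq> frontier (outside (drawing G pos curve))"
  proof
    fix z assume "z \<in> pos ` verts G"
    then have z: "z \<in> drawing G pos curve" "Im z = (Re z)\<^sup>2"
      by (auto simp: drawing_def pos_def)
    have D: "(Re w)\<^sup>2 \<le> Im w" if "w \<in> drawing G pos curve" for w
      using that above by (auto simp: drawing_def pos_def)
    have "\<exists>y\<in>outside (drawing G pos curve). dist y z < r" if "r > 0" for r
    proof
      show "z - Complex 0 (r / 2) \<in> outside (drawing G pos curve)"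
        using D z(2) that by (intro below_parab_in_outside) auto
      show "dist (z - Complex 0 (r / 2)) z < r"
        using that by (simp add: dist_norm norm_complex_def)
    qed
    then have "z \<in> closure (outside (drawing G pos curve))"
      by (auto simp: closure_approachable)
    moreover have "z \<notin> interior (outside (drawing G pos curve))"
      using z(1) outside_no_overlap interior_subset by blast
    ultimately show "z \<in> frontier (outside (drawing G pos curve))"
      by (simp add: frontier_def)
  qed
  ultimately show ?thesis
    unfolding outerplanar_def by blast
qed

section \<open>Neighbourhoods in graphs containing a double star\<close>

definition nbrs :: "'a graph \<Rightarrow> 'a \<Rightarrow> 'a set" where
  "nbrs G v = {u. {u, v} \<in> edges G}"

lemma finite_nbrs: "simple_graph G \<Longrightarrow> finite (nbrs G v)"
  by (rule finite_subset[of _ "verts G"]) (auto simp: simple_graph_def nbrs_def)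

text \<open>The centres are pulled back along the isomorphism. Each is a neighbour of the other,
  which gives the \<open>+ 1\<close> and lets the two neighbourhoods cover all
  \<open>p + q + 2\<close> vertices.\<close>

lemma double_star_nbrs:
  assumes G: "simple_graph G" and nfree: "\<not> graph_free (double_star p q) G"
  obtains x y where "{x, y} \<in> edges G" "q + 1 \<le> card (nbrs G y)"
    "p + q + 2 \<le> card (nbrs G x \<union> nbrs G y)"
proof -
  obtain G' f where G': "subgraph G' G" and bij: "bij_betw f (verts G') {..<p + q + 2}"
    and iso: "\<And>u v. u \<in> verts G' \<Longrightarrow> v \<in> verts G' \<Longrightarrow>
      {u, v} \<in> edges G' \<longleftrightarrow> {f u, f v} \<in> edges (double_star p q)"
    using nfree by (auto simp: graph_free_def isomorphic_def double_star_def)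
  define g where "g = inv_into (verts G') f"
  have g: "bij_betw g {..<p + q + 2} (verts G')"
    unfolding g_def by (rule bij_betw_inv_into[OF bij])
  have edge: "{g i, g j} \<in> edges G"
    if "{i, j} \<in> edges (double_star p q)" "i < p + q + 2" "j < p + q + 2" for i j
  proof -
    have "g i \<in> verts G'" "g j \<in> verts G'"
      using that g by (auto simp: bij_betw_def)
    moreover have "f (g i) = i" "f (g j) = j"
      using that bij unfolding g_def by (simp_all add: bij_betw_inv_into_right)
    ultimately have "{g i, g j} \<in> edges G'"
      using iso that by simp
    then show ?thesis
      using G' by (auto simp: subgraph_def)
  qed
  have 0: "g ` ({1} \<union> {2..<p + 2}) \<subseteq> nbrs G (g 0)"
    by (auto simp: nbrs_def intro!: edge) (auto simp: double_star_def insert_commute)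
  have 1: "g ` ({0} \<union> {p + 2..<p + q + 2}) \<subseteq> nbrs G (g 1)"
    by (auto simp: nbrs_def intro!: edge) (auto simp: double_star_def insert_commute)
  have card_g: "card (g ` A) = card A" if "A \<subseteq> {..<p + q + 2}" for A
    using that g by (meson bij_betw_def card_image inj_on_subset)
  show ?thesis
  proof
    show "{g 0, g 1} \<in> edges G"
      by (rule edge) (auto simp: double_star_def)
    have "card (g ` ({0} \<union> {p + 2..<p + q + 2})) = q + 1"
      by (subst card_g) auto
    then show "q + 1 \<le> card (nbrs G (g 1))"
      using card_mono[OF finite_nbrs[OF G] 1] by simp
    have "{..<p + q + 2} = ({1} \<union> {2..<p + 2}) \<union> ({0} \<union> {p + 2..<p + q + 2})"
      by auto
    then have "g ` {..<p + q + 2} \<subseteq> nbrs G (g 0) \<union> nbrs G (g 1)"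
      using 0 1 by (metis image_Un Un_mono)
    then have "card (g ` {..<p + q + 2}) \<le> card (nbrs G (g 0) \<union> nbrs G (g 1))"
      by (intro card_mono) (auto intro: finite_nbrs[OF G])
    then show "p + q + 2 \<le> card (nbrs G (g 0) \<union> nbrs G (g 1))"
      by (simp add: card_g)
  qed
qed

section \<open>The chain of hexagons\<close>

text \<open>Hexagon \<open>j\<close> has the vertices \<open>6 * j + r\<close> with \<open>r < 6\<close>; its inner triangle is formed by
  \<open>r = 1, 2, 3\<close>, and \<open>r = 0, 5\<close> carry the links to the neighbouring hexagons.\<close>
definition preds :: "nat \<Rightarrow> nat set" where
  "preds v = (if v = 0 then {}
     else if v mod 6 \<le> 1 then {v - 1}
     else if v mod 6 \<le> 3 then {v - 1, v - 2}
     else if v mod 6 = 4 then {v - 1, v - 3}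
     else {v - 2, v - 3})"

definition hexchain :: "nat \<Rightarrow> nat graph" where
  "hexchain n = Graph {..<n} (\<Union>v<n. (\<lambda>u. {u, v}) ` preds v)"

lemma finite_preds: "finite (preds v)" and preds_less: "u \<in> preds v \<Longrightarrow> u < v"
  by (auto simp: preds_def split: if_splits)

lemma preds_block:
  "preds (6 * j) = (if j = 0 then {} else {6 * j - 1})"
  "preds (6 * j + 1) = {6 * j}"
  "preds (6 * j + 2) = {6 * j + 1, 6 * j}"
  "preds (6 * j + 3) = {6 * j + 2, 6 * j + 1}"
  "preds (6 * j + 4) = {6 * j + 3, 6 * j + 1}"
  "preds (6 * j + 5) = {6 * j + 3, 6 * j + 2}"
proof -
  have "(6 * j + r) mod 6 = r" if "r < 6" for r
    using that by simp
  from this[of 0] this[of 1] this[of 2] this[of 3] this[of 4] this[of 5]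
  show "preds (6 * j) = (if j = 0 then {} else {6 * j - 1})"
    "preds (6 * j + 1) = {6 * j}"
    "preds (6 * j + 2) = {6 * j + 1, 6 * j}"
    "preds (6 * j + 3) = {6 * j + 2, 6 * j + 1}"
    "preds (6 * j + 4) = {6 * j + 3, 6 * j + 1}"
    "preds (6 * j + 5) = {6 * j + 3, 6 * j + 2}"
    by (auto simp: preds_def)
qed

lemma nat_mod6_cases:
  fixes v :: nat
  obtains j where "v = 6 * j" | j where "v = 6 * j + 1" | j where "v = 6 * j + 2"
  | j where "v = 6 * j + 3" | j where "v = 6 * j + 4" | j where "v = 6 * j + 5"
proof -
  have "v = 6 * (v div 6) + v mod 6" "v mod 6 < 6"
    by simp_all
  then show ?thesis
    using that by (metis add.right_neutral less_Suc_eq not_less0 numeral_eq_Suc pred_numeral_simps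
      numeral_nat)
qed

lemma simple_hexchain: "simple_graph (hexchain n)"
  by (force simp: simple_graph_def hexchain_def card_2_iff dest: preds_less)

lemma hexchain_edge_iff:
  "{u, v} \<in> edges (hexchain n) \<longleftrightarrow> u < n \<and> v < n \<and> (u \<in> preds v \<or> v \<in> preds u)"
  by (force simp: hexchain_def doubleton_eq_iff dest: preds_less)

section \<open>Counting the edges of the chain\<close>

text \<open>Each edge is introduced at its larger endpoint, so the new vertex \<open>n\<close>
  brings exactly its edges to \<open>preds n\<close>.\<close>

lemma card_edges_Suc: "card (edges (hexchain (Suc n))) = card (edges (hexchain n)) + card (preds n)"
proof -
  have "edges (hexchain (Suc n)) = edges (hexchain n) \<union> (\<lambda>u. {u, n}) ` preds n"
    by (simp add: hexchain_def lessThan_Suc Un_commute)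
  moreover have "edges (hexchain n) \<inter> (\<lambda>u. {u, n}) ` preds n = {}"
    by (auto simp: hexchain_edge_iff)
  moreover have "finite (edges (hexchain n))"
    by (simp add: hexchain_def finite_preds)
  moreover have "card ((\<lambda>u. {u, n}) ` preds n) = card (preds n)"
    by (intro card_image) (auto simp: inj_on_def doubleton_eq_iff)
  ultimately show ?thesis
    by (simp add: card_Un_disjoint finite_preds)
qed

text \<open>From \<open>6 * k + 1\<close> on, six successive vertices bring 1, 2, 2, 2, 2, 1 edges.
  Starting there rather than at \<open>6 * k\<close> keeps the formulas uniform, since vertex 0 has
  no link back.\<close>

lemma card_edges_block:
  "card (edges (hexchain (6 * k + 1))) = 10 * k" (is ?Pa)
  "card (edges (hexchain (6 * k + 2))) = 10 * k + 1" (is ?Pb)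
  "card (edges (hexchain (6 * k + 3))) = 10 * k + 3" (is ?Pc)
  "card (edges (hexchain (6 * k + 4))) = 10 * k + 5" (is ?Pd)
  "card (edges (hexchain (6 * k + 5))) = 10 * k + 7" (is ?Pe)
  "card (edges (hexchain (6 * k + 6))) = 10 * k + 9" (is ?Pf)
proof -
  have step: "card (edges (hexchain (6 * k + Suc r))) =
      card (edges (hexchain (6 * k + r))) + card (preds (6 * k + r))" for k r
    by (simp add: card_edges_Suc)
  note steps = step[of _ 0] step[of _ 1] step[of _ 2] step[of _ 3] step[of _ 4] step[of _ 5]
  have *: "?Pa \<and> ?Pb \<and> ?Pc \<and> ?Pd \<and> ?Pe \<and> ?Pf"
  proof (induction k)
    case 0
    have "card (edges (hexchain 0)) = 0"
      by (simp add: hexchain_def)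
    then show ?case
      using steps[of 0] preds_block[of 0] by (simp add: eval_nat_numeral)
  next
    case (Suc k)
    then show ?case
      using steps[of "Suc k"] preds_block[of "Suc k"]
      by (simp add: numeral_eq_Suc card_insert_if)
  qed
  then show ?Pa ?Pb ?Pc ?Pd ?Pe ?Pf
    by auto
qed

section \<open>Neighbourhoods in the chain and double-star freeness\<close>

text \<open>These are the nine edges of hexagon \<open>i\<close> and its link to the next one;
  indexing the link by the lower hexagon avoids truncated subtraction.\<close>

lemma preds_cases:
  assumes "v \<in> preds u"
  obtains i where
    "u = 6 * i + 6 \<and> v = 6 * i + 5 \<or> u = 6 * i + 1 \<and> v = 6 * i \<or>
     u = 6 * i + 2 \<and> v = 6 * i + 1 \<or> u = 6 * i + 2 \<and> v = 6 * i \<or>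
     u = 6 * i + 3 \<and> v = 6 * i + 2 \<or> u = 6 * i + 3 \<and> v = 6 * i + 1 \<or>
     u = 6 * i + 4 \<and> v = 6 * i + 3 \<or> u = 6 * i + 4 \<and> v = 6 * i + 1 \<or>
     u = 6 * i + 5 \<and> v = 6 * i + 3 \<or> u = 6 * i + 5 \<and> v = 6 * i + 2"
proof (cases u rule: nat_mod6_cases)
  case (1 j)
  then obtain i where "j = Suc i" "v = 6 * j - 1"
    using assms preds_block(1)[of j] by (cases j) auto
  then show ?thesis
    using that[of i] 1 by auto
next
  case (2 j)
  then show ?thesis
    using that[of j] assms preds_block(2)[of j] by auto
next
  case (3 j)
  then show ?thesis
    using that[of j] assms preds_block(3)[of j] by auto
next
  case (4 j)
  then show ?thesis
    using that[of j] assms preds_block(4)[of j] by auto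
next
  case (5 j)
  then show ?thesis
    using that[of j] assms preds_block(5)[of j] by auto
next
  case (6 j)
  then show ?thesis
    using that[of j] assms preds_block(6)[of j] by auto
qed

text \<open>Inclusions suffice for upper bounds and cover chains cut off at \<open>n\<close>. For
  \<open>j = 0\<close> the entry \<open>6 * j - 1\<close> is 0, a harmless extra element.\<close>

lemma nbrs_block:
  "nbrs (hexchain n) (6 * j) \<subseteq> {6 * j - 1, 6 * j + 1, 6 * j + 2}" (is ?A)
  "nbrs (hexchain n) (6 * j + 1) \<subseteq> {6 * j, 6 * j + 2, 6 * j + 3, 6 * j + 4}" (is ?B)
  "nbrs (hexchain n) (6 * j + 2) \<subseteq> {6 * j, 6 * j + 1, 6 * j + 3, 6 * j + 5}" (is ?C)
  "nbrs (hexchain n) (6 * j + 3) \<subseteq> {6 * j + 1, 6 * j + 2, 6 * j + 4, 6 * j + 5}" (is ?D)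
  "nbrs (hexchain n) (6 * j + 4) \<subseteq> {6 * j + 1, 6 * j + 3}" (is ?E)
  "nbrs (hexchain n) (6 * j + 5) \<subseteq> {6 * j + 2, 6 * j + 3, 6 * j + 6}" (is ?F)
proof -
  have nbrsI: "nbrs (hexchain n) v \<subseteq> A"
    if "\<And>u. u \<in> preds v \<Longrightarrow> u \<in> A" "\<And>u. v \<in> preds u \<Longrightarrow> u \<in> A" for v A
    using that by (auto simp: nbrs_def hexchain_edge_iff)
  show ?A ?B ?C ?D ?E ?F
    by - (rule nbrsI; erule preds_cases; unfold insert_iff empty_iff; elim disjE conjE; presburger)+
qed

lemma card_le_if_subset_set: "A \<subseteq> set xs \<Longrightarrow> card A \<le> length xs"
  using card_mono[of "set xs" A] card_length[of xs] by simp

text \<open>Degree 4 puts \<open>y\<close> on an inner triangle. The union stays in one hexagon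
  unless \<open>x\<close> carries a link; then one outside vertex may enter, but a vertex of the
  hexagon is missed.\<close>

lemma hexchain_nbrs_small:
  assumes edge: "{x, y} \<in> edges (hexchain n)" and deg: "4 \<le> card (nbrs (hexchain n) y)"
  shows "card (nbrs (hexchain n) x \<union> nbrs (hexchain n) y) \<le> 6"
proof -
  let ?N = "nbrs (hexchain n)"
  have x: "x \<in> ?N y"
    using edge by (simp add: nbrs_def)
  have le6: ?thesis if "?N x \<union> ?N y \<subseteq> set xs" "length xs = 6" for xs
    using card_le_if_subset_set[OF that(1)] that(2) by simp
  show ?thesis
  proof (cases y rule: nat_mod6_cases)
    case (1 j)
    then show ?thesis
      using deg nbrs_block(1)[of n j] card_le_if_subset_set[of _ "[_, _, _]"] by fastforce
  next
    case (2 j)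
    then consider "x = 6 * j" | "x = 6 * j + 2" | "x = 6 * j + 3" | "x = 6 * j + 4"
      using x nbrs_block(2) by blast
    then show ?thesis
    proof cases
      case 1
      show ?thesis
        by (rule le6[of "[6 * j - 1, 6 * j, 6 * j + 1, 6 * j + 2, 6 * j + 3, 6 * j + 4]"])
          (use nbrs_block(1,2)[of n j] \<open>y = _\<close> 1 in auto)
    qed (rule le6[of "map ((+) (6 * j)) [0, 1, 2, 3, 4, 5]"];
      use nbrs_block[of n j] \<open>y = _\<close> in auto)+
  next
    case (3 j)
    then consider "x = 6 * j" | "x = 6 * j + 1" | "x = 6 * j + 3" | "x = 6 * j + 5"
      using x nbrs_block(3) by blast
    then show ?thesis
    proof cases
      case 1
      show ?thesis
        by (rule le6[of "[6 * j - 1, 6 * j, 6 * j + 1, 6 * j + 2, 6 * j + 3, 6 * j + 5]"])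
          (use nbrs_block(1,3)[of n j] \<open>y = _\<close> 1 in auto)
    next
      case 4
      show ?thesis
        by (rule le6[of "map ((+) (6 * j)) [0, 1, 2, 3, 5, 6]"])
          (use nbrs_block(3,6)[of n j] \<open>y = _\<close> 4 in auto)
    qed (rule le6[of "map ((+) (6 * j)) [0, 1, 2, 3, 4, 5]"];
      use nbrs_block[of n j] \<open>y = _\<close> in auto)+
  next
    case (4 j)
    then consider "x = 6 * j + 1" | "x = 6 * j + 2" | "x = 6 * j + 4" | "x = 6 * j + 5"
      using x nbrs_block(4) by blast
    then show ?thesis
    proof cases
      case 4
      show ?thesis
        by (rule le6[of "map ((+) (6 * j)) [1, 2, 3, 4, 5, 6]"])
          (use nbrs_block(4,6)[of n j] \<open>y = _\<close> 4 in auto)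
    qed (rule le6[of "map ((+) (6 * j)) [0, 1, 2, 3, 4, 5]"];
      use nbrs_block[of n j] \<open>y = _\<close> in auto)+
  next
    case (5 j)
    then show ?thesis
      using deg nbrs_block(5)[of n j] card_le_if_subset_set[of _ "[_, _]"] by fastforce
  next
    case (6 j)
    then show ?thesis
      using deg nbrs_block(6)[of n j] card_le_if_subset_set[of _ "[_, _, _]"] by fastforce
  qed
qed

lemma hexchain_double_star_free: "graph_free (double_star 2 3) (hexchain n)"
proof (rule ccontr)
  assume "\<not> ?thesis"
  from double_star_nbrs[OF simple_hexchain this] obtain x y where
    "{x, y} \<in> edges (hexchain n)" "3 + 1 \<le> card (nbrs (hexchain n) y)"
    "2 + 3 + 2 \<le> card (nbrs (hexchain n) x \<union> nbrs (hexchain n) y)" .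
  then show False
    using hexchain_nbrs_small[of x y n] by simp
qed

section \<open>Outerplanarity of the chain\<close>

text \<open>The cyclic order along the outer face: hexagon \<open>j + 1\<close> is inserted between the vertices
  \<open>6 * j + 5\<close> and \<open>6 * j + 2\<close> of hexagon \<open>j\<close>, the latter being moved to the negative side.\<close>
definition hexpos :: "nat \<Rightarrow> int" where
  "hexpos v = (let j = int (v div 6) in
     [5 * j, 5 * j + 1, - 1 - j, 5 * j + 3, 5 * j + 2, 5 * j + 4] ! (v mod 6))"

lemma hexpos_block:
  "hexpos (6 * j) = 5 * int j" "hexpos (6 * j + 1) = 5 * int j + 1"
  "hexpos (6 * j + 2) = - 1 - int j" "hexpos (6 * j + 3) = 5 * int j + 3"
  "hexpos (6 * j + 4) = 5 * int j + 2" "hexpos (6 * j + 5) = 5 * int j + 4"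
  "hexpos (6 * j + 6) = 5 * int j + 5"
proof -
  have "(6 * j + r) div 6 = j" "(6 * j + r) mod 6 = r" if "r < 6" for r
    using that by simp_all
  from this[of 0] this[of 1] this[of 2] this[of 3] this[of 4] this[of 5]
  show "hexpos (6 * j) = 5 * int j" "hexpos (6 * j + 1) = 5 * int j + 1"
    "hexpos (6 * j + 2) = - 1 - int j" "hexpos (6 * j + 3) = 5 * int j + 3"
    "hexpos (6 * j + 4) = 5 * int j + 2" "hexpos (6 * j + 5) = 5 * int j + 4"
    by (simp_all add: hexpos_def Let_def)
  have "6 * j + 6 = 6 * (j + 1)"
    by simp
  then show "hexpos (6 * j + 6) = 5 * int j + 5"
    unfolding hexpos_def Let_def by (simp del: mult_Suc_right)
qed

text \<open>Only residue 2 modulo 6 gives negative values; the other five residues fill the five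
  classes modulo 5.\<close>

lemma inj_hexpos: "inj hexpos"
proof (rule injI)
  fix u v assume "hexpos u = hexpos v"
  then show "u = v"
    by (cases u rule: nat_mod6_cases; cases v rule: nat_mod6_cases; simp only: hexpos_block; presburger)
qed

text \<open>The chords of the infinite chain, oriented left to right: a fan at each vertex
  \<open>6 * j + 2\<close>, the path on the nonnegative side, and the triangle side from
  \<open>6 * j + 1\<close> to \<open>6 * j + 3\<close>.\<close>

definition hexchord :: "int \<Rightarrow> int \<Rightarrow> bool" where
  "hexchord a b \<longleftrightarrow>
     (\<exists>j\<ge>0. a = - 1 - j \<and> b \<in> {5 * j, 5 * j + 1, 5 * j + 3, 5 * j + 4}) \<or>
     (0 \<le> a \<and> b = a + 1) \<or> (\<exists>j\<ge>0. a = 5 * j + 1 \<and> b = 5 * j + 3)"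

lemma hexchord_preds:
  assumes "v \<in> preds u"
  shows "hexchord (hexpos u) (hexpos v) \<or> hexchord (hexpos v) (hexpos u)"
  using assms unfolding hexchord_def
  by (elim preds_cases disjE conjE; simp only: hexpos_block; force)

text \<open>Fans are nested: as \<open>j\<close> grows, the left end moves left and the block of
  right ends moves right. Unit chords have no integer inside, and the only one inside a triangle
  side, \<open>5 * j + 2\<close>, is an end of unit chords only.\<close>

lemma hexchord_noncrossing:
  assumes "hexchord a b" "hexchord c d"
  shows "\<not> (a < c \<and> c < b \<and> b < d)"
  using assms unfolding hexchord_def by (elim disjE exE conjE; auto; arith)

lemma hexchain_outerplanar: "outerplanar (hexchain n)"
proof (rule outerplanar_if_noncrossing[of _ "\<lambda>v. real_of_int (hexpos v)"])
  show "simple_graph (hexchain n)"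
    by (rule simple_hexchain)
  show "inj_on (\<lambda>v. real_of_int (hexpos v)) (verts (hexchain n))"
    using inj_hexpos by (auto simp: inj_on_def)
  fix a b c d
  assume "{a, b} \<in> edges (hexchain n)" "{c, d} \<in> edges (hexchain n)"
  then have "hexchord (hexpos a) (hexpos b) \<or> hexchord (hexpos b) (hexpos a)"
    "hexchord (hexpos c) (hexpos d) \<or> hexchord (hexpos d) (hexpos c)"
    by (auto simp: hexchain_edge_iff dest: hexchord_preds)
  \<comment> \<open>A crossing would put \<open>a\<close> before \<open>b\<close> and
    \<open>c\<close> before \<open>d\<close>, which selects the orientation in each
    disjunction.\<close>
  moreover have "x < y" if "hexchord x y" for x y
    using that by (auto simp: hexchord_def)
  ultimately show "\<not> (real_of_int (hexpos a) < real_of_int (hexpos c) \<and>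
      real_of_int (hexpos c) < real_of_int (hexpos b) \<and>
      real_of_int (hexpos b) < real_of_int (hexpos d))"
    using hexchord_noncrossing[of "hexpos a" "hexpos b" "hexpos c" "hexpos d"]
    by (metis of_int_less_iff less_trans not_less_iff_gr_or_eq)
qed

section \<open>The lower bound\<close>

lemma card_edges_le_ex_OP: "card (edges (hexchain n)) \<le> ex_OP n (double_star 2 3)"
proof -
  have "card (verts (hexchain n)) = n"
    by (simp add: hexchain_def)
  then have "card (edges (hexchain n)) \<in> outerplanar_edge_counts n (double_star 2 3)"
    unfolding outerplanar_edge_counts_def
    using simple_hexchain hexchain_outerplanar hexchain_double_star_free by blast
  then show ?thesis
    unfolding ex_OP_def by (intro Max_ge finite_outerplanar_edge_counts)
qed

theorem theorem5:
  fixes n :: nat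
  assumes "n \<ge> 7"
  shows "real (ex_OP n (double_star 2 3)) \<ge>
    (if n mod 6 = 0 then (5 * real n - 3) / 3
     else if n mod 6 = 1 then (5 * real n - 5) / 3
     else (5 * real n + real (n mod 6) - 9) / 3)"
proof -
  \<comment> \<open>For residues \<open>i\<close> from 2 to 5 and \<open>n = 6 * k + i\<close>, the
    count is \<open>10 * k + 2 * i - 3\<close>, matching the third formula.\<close>
  have "real (card (edges (hexchain n))) =
    (if n mod 6 = 0 then (5 * real n - 3) / 3
     else if n mod 6 = 1 then (5 * real n - 5) / 3
     else (5 * real n + real (n mod 6) - 9) / 3)"
  proof (cases n rule: nat_mod6_cases)
    case (1 j)
    \<comment> \<open>The count for residue 0 is stated at \<open>6 * k + 6\<close>, so
      \<open>k = j - 1\<close>; here \<open>j > 0\<close> because \<open>n \<ge> 7\<close>.\<close>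
    then obtain k where "n = 6 * k + 6"
      using assms by (cases j) auto
    then show ?thesis
      by (simp only: card_edges_block) simp
  next
    case (2 j)
    then show ?thesis
      by (simp only: card_edges_block) (simp add: mod_Suc)
  next
    case (3 j)
    then show ?thesis
      by (simp only: card_edges_block) (simp add: mod_Suc)
  qed (simp only: card_edges_block; simp)+
  then show ?thesis
    using card_edges_le_ex_OP[of n] by simp
qed

end
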